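(* Let $a\in\mathbb{D}$, $a\ne 0$. There exist no geodesics of the Grassmann manifold of $H^2$ joining $N(C_0+I)$ and $N(C_a-I)$.
   Context: $\mathbb{D}$ is the open unit disk and $H^2=H^2(\mathbb{D})$ the Hardy space. For $a\in\mathbb{D}$, $\varphi_a(z)=\frac{a-z}{1-\bar a z}$ and $C_a:H^2\to H^2$, $C_af=f\circ\varphi_a$ (so $C_0f(z)=f(-z)$); $N(\cdot)$ is the nullspace. The Grassmann manifold of $H^2$ is the set of closed subspaces of $H^2$. A geodesic joining closed subspaces $\mathcal{S}$ and $\mathcal{T}$ is a curve $\delta(t)=e^{itX}\mathcal{S}$, $t\in[0,1]$, with $\delta(1)=\mathcal{T}$, where $X=X^*$ is a bounded operator on $H^2$ that is co-diagonal with respect to both $\mathcal{S}$ and $\mathcal{T}$ (i.e. $X(\mathcal{S})\subset\mathcal{S}^\perp$, $X(\mathcal{S}^\perp)\subset\mathcal{S}$, and likewise for $\mathcal{T}$). Known fact: such a geodesic exists if and only if $\dim(\mathcal{S}\cap\mathcal{T}^\perp)=\dim(\mathcal{S}^\perp\cap\mathcal{T})$. *)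

theory Defs
  imports "HOL-Complex_Analysis.Complex_Analysis"
begin

section \<open>Taylor coefficients at the origin\<close>

definition taylor :: "(complex \<Rightarrow> complex) \<Rightarrow> nat \<Rightarrow> complex" where
  "taylor f n = (deriv ^^ n) f 0 / fact n"

lemma taylor_sums:
  assumes "f holomorphic_on ball 0 r" "norm z < r"
  shows "(\<lambda>n. taylor f n * z ^ n) sums f z"
  using holomorphic_power_series[OF assms(1), of z] assms(2) by (simp add: taylor_def)

lemma taylor_unique:
  assumes r: "r > 0" and s: "\<And>z. norm z < r \<Longrightarrow> (\<lambda>n. c n * z ^ n) sums f z"
  shows "taylor f n = c n"
proof -
  have sm: "summable (\<lambda>n. c n * (of_real (r/2)) ^ n)"
    using s[of "of_real (r/2)"] r by (auto simp: sums_iff)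
  have rad: "fps_conv_radius (Abs_fps c) \<ge> ereal (r/2)"
    unfolding fps_conv_radius_def
    using conv_radius_geI[OF sm] r by simp
  have "0 < fps_conv_radius (Abs_fps c)"
    using rad r less_le_trans[of 0 "ereal (r/2)"] by simp
  moreover have "eventually (\<lambda>z. z \<in> ball 0 r) (nhds (0::complex))"
    using r by (intro eventually_nhds_in_open) auto
  then have "eventually (\<lambda>z. eval_fps (Abs_fps c) z = f z) (nhds 0)"
  proof (rule eventually_mono)
    fix z :: complex assume "z \<in> ball 0 r"
    then show "eval_fps (Abs_fps c) z = f z"
      using s[of z] by (simp add: eval_fps_def sums_iff)
  qed
  ultimately have "f has_fps_expansion Abs_fps c"
    by (simp add: has_fps_expansion_def)
  from fps_nth_fps_expansion[OF this, of n] show ?thesis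
    by (simp add: taylor_def)
qed

lemma taylor_holomorphic:
  assumes "\<And>z. norm z < r \<Longrightarrow> (\<lambda>n. c n * z ^ n) sums f z"
  shows "f holomorphic_on ball 0 r"
  using power_series_holomorphic[of 0 r c f] assms by simp

lemma taylor_cong:
  assumes "f holomorphic_on ball 0 r" "r > 0" "\<And>z. norm z < r \<Longrightarrow> f z = g z"
  shows "taylor g n = taylor f n"
  by (rule taylor_unique[OF assms(2)]) (use taylor_sums[OF assms(1)] assms(3) in auto)

lemma taylor_add:
  assumes "f holomorphic_on ball 0 r" "g holomorphic_on ball 0 r" "r > 0"
  shows "taylor (\<lambda>z. f z + g z) n = taylor f n + taylor g n"
  by (rule taylor_unique[OF assms(3)])
     (use sums_add[OF taylor_sums[OF assms(1)] taylor_sums[OF assms(2)]] in \<open>auto simp: algebra_simps\<close>)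

lemma taylor_cmult:
  assumes "f holomorphic_on ball 0 r" "r > 0"
  shows "taylor (\<lambda>z. c * f z) n = c * taylor f n"
  by (rule taylor_unique[OF assms(2)])
     (use sums_mult[OF taylor_sums[OF assms(1)], of _ c] in \<open>auto simp: algebra_simps\<close>)

lemma taylor_sum:
  assumes "\<And>i. i \<in> I \<Longrightarrow> f i holomorphic_on ball 0 r" "r > 0"
  shows "taylor (\<lambda>z. \<Sum>i\<in>I. f i z) n = (\<Sum>i\<in>I. taylor (f i) n)"
  by (rule taylor_unique[OF assms(2)])
     (use taylor_sums[OF assms(1)] in \<open>auto simp: sum_distrib_right intro!: sums_sum\<close>)

section \<open>Square-summable sequences\<close>

lemma sq_add_le: "(norm (x + y :: complex))\<^sup>2 \<le> 2 * (norm x)\<^sup>2 + 2 * (norm y)\<^sup>2"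
proof -
  have "(norm (x + y))\<^sup>2 \<le> (norm x + norm y)\<^sup>2"
    by (intro power_mono norm_triangle_ineq) auto
  also have "\<dots> \<le> 2 * (norm x)\<^sup>2 + 2 * (norm y)\<^sup>2"
    using sum_squares_bound[of "norm x" "norm y"] by (simp add: power2_sum)
  finally show ?thesis .
qed

lemma l2_add:
  fixes c d :: "nat \<Rightarrow> complex"
  assumes "summable (\<lambda>n. (norm (c n))\<^sup>2)" "summable (\<lambda>n. (norm (d n))\<^sup>2)"
  shows "summable (\<lambda>n. (norm (c n + d n))\<^sup>2)"
  by (rule summable_comparison_test'[where N=0, OF summable_add[OF summable_mult[OF assms(1), of 2] summable_mult[OF assms(2), of 2]]])
     (use sq_add_le in auto)

lemma l2_cmult:
  fixes c :: "nat \<Rightarrow> complex"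
  assumes "summable (\<lambda>n. (norm (c n))\<^sup>2)"
  shows "summable (\<lambda>n. (norm (k * c n))\<^sup>2)"
  using summable_mult[OF assms, of "(norm k)\<^sup>2"] by (simp add: norm_mult power_mult_distrib)

lemma l2_abs_summable_mult:
  fixes c d :: "nat \<Rightarrow> complex"
  assumes "summable (\<lambda>n. (norm (c n))\<^sup>2)" "summable (\<lambda>n. (norm (d n))\<^sup>2)"
  shows "summable (\<lambda>n. norm (c n * d n))"
proof (rule summable_comparison_test'[where N=0, OF summable_add[OF assms]])
  fix n :: nat
  have "2 * norm (c n) * norm (d n) \<le> (norm (c n))\<^sup>2 + (norm (d n))\<^sup>2"
    by (rule sum_squares_bound)
  moreover have "0 \<le> norm (c n) * norm (d n)" by simp
  ultimately have "norm (c n) * norm (d n) \<le> (norm (c n))\<^sup>2 + (norm (d n))\<^sup>2"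
    by linarith
  then show "norm (norm (c n * d n)) \<le> (norm (c n))\<^sup>2 + (norm (d n))\<^sup>2"
    by (simp add: norm_mult)
qed

lemma l2_summable_mult_cnj:
  fixes c d :: "nat \<Rightarrow> complex"
  assumes "summable (\<lambda>n. (norm (c n))\<^sup>2)" "summable (\<lambda>n. (norm (d n))\<^sup>2)"
  shows "summable (\<lambda>n. c n * cnj (d n))"
  by (rule summable_norm_cancel, rule l2_abs_summable_mult) (use assms in auto)

lemma l2_power_sums:
  fixes c :: "nat \<Rightarrow> complex"
  assumes "summable (\<lambda>n. (norm (c n))\<^sup>2)" "norm z < 1"
  shows "summable (\<lambda>n. norm (c n * z ^ n))"
proof (rule l2_abs_summable_mult[OF assms(1)])
  have "(norm z)\<^sup>2 < 1" using assms(2) by (simp add: abs_square_less_1)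
  then show "summable (\<lambda>n. (norm (z ^ n))\<^sup>2)"
    using summable_geometric[of "(norm z)\<^sup>2"] by (simp add: norm_power power_mult[symmetric] mult.commute)
qed

lemma l1_imp_l2:
  fixes c :: "nat \<Rightarrow> complex"
  assumes "summable (\<lambda>n. norm (c n))"
  shows "summable (\<lambda>n. (norm (c n))\<^sup>2)"
proof -
  have "eventually (\<lambda>n. norm (c n) < 1) sequentially"
    using summable_LIMSEQ_zero[OF assms] by (rule order_tendstoD) simp
  then have "eventually (\<lambda>n. norm ((norm (c n))\<^sup>2) \<le> norm (c n)) sequentially"
    by (rule eventually_mono) (simp add: power2_eq_square mult_left_le)
  then show ?thesis using assms by (rule summable_comparison_test_ev)
qed

section \<open>The Hardy space\<close>

text \<open>
  The elements of $H^2$ are the holomorphic functions on the open unit disk with square-summable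
  Taylor coefficients.  They are represented by total functions that vanish off the disk, so that
  equality in the type is equality of functions on the disk.
\<close>

definition hardy_set :: "(complex \<Rightarrow> complex) set" where
  "hardy_set = {f. f holomorphic_on ball 0 1 \<and> summable (\<lambda>n. (norm (taylor f n))\<^sup>2) \<and>
                   (\<forall>z. z \<notin> ball 0 1 \<longrightarrow> f z = 0)}"

lemma hardy_set_add:
  assumes "f \<in> hardy_set" "g \<in> hardy_set" shows "(\<lambda>z. f z + g z) \<in> hardy_set"
proof -
  have h: "f holomorphic_on ball 0 1" "g holomorphic_on ball 0 1" using assms by (auto simp: hardy_set_def)
  show ?thesis using assms h unfolding hardy_set_def mem_Collect_eq
    by (auto intro!: holomorphic_intros l2_add simp: taylor_add[OF h])
qed

lemma hardy_set_cmult: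
  assumes "f \<in> hardy_set" shows "(\<lambda>z. c * f z) \<in> hardy_set"
proof -
  have h: "f holomorphic_on ball 0 1" using assms by (auto simp: hardy_set_def)
  show ?thesis using assms h unfolding hardy_set_def mem_Collect_eq
    by (auto intro!: holomorphic_intros l2_cmult simp: taylor_cmult[OF h])
qed

lemma hardy_set_zero: "(\<lambda>z. 0) \<in> hardy_set"
  using taylor_unique[of 1 "\<lambda>_. 0" "\<lambda>_. 0"] by (simp add: hardy_set_def)

lemma hardy_set_of_seq:
  fixes c :: "nat \<Rightarrow> complex"
  assumes "summable (\<lambda>n. (norm (c n))\<^sup>2)"
  defines "f \<equiv> \<lambda>z. if norm z < 1 then \<Sum>n. c n * z ^ n else 0"
  shows "f \<in> hardy_set" "taylor f n = c n"
proof -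
  have s: "(\<lambda>n. c n * z ^ n) sums f z" if "norm z < 1" for z
    using l2_power_sums[OF assms(1) that, THEN summable_norm_cancel] that
    by (simp add: f_def summable_sums)
  show t: "taylor f n = c n" for n by (rule taylor_unique[of 1]) (use s in auto)
  show "f \<in> hardy_set"
    using taylor_holomorphic[OF s] assms(1) by (simp add: hardy_set_def t) (simp add: f_def)
qed

typedef hardy = hardy_set morphisms hfun Abs_hardy
  using hardy_set_zero by blast

definition hcoeff :: "hardy \<Rightarrow> nat \<Rightarrow> complex" where
  "hcoeff f = taylor (hfun f)"

lemma hfun_holomorphic: "hfun f holomorphic_on ball 0 1"
  and hcoeff_l2: "summable (\<lambda>n. (norm (hcoeff f n))\<^sup>2)"
  and hfun_off: "\<not> norm z < 1 \<Longrightarrow> hfun f z = 0"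
  using hfun[of f] by (auto simp: hardy_set_def hcoeff_def)

lemma hfun_sums: "norm z < 1 \<Longrightarrow> (\<lambda>n. hcoeff f n * z ^ n) sums hfun f z"
  unfolding hcoeff_def by (rule taylor_sums[OF hfun_holomorphic])

lemma hardy_eqI:
  assumes "\<And>z. norm z < 1 \<Longrightarrow> hfun f z = hfun g z" shows "f = g"
proof -
  have "hfun f = hfun g" using assms hfun_off[of _ f] hfun_off[of _ g] by (metis ext)
  then show ?thesis by (simp add: hfun_inject)
qed

lemma hardy_eqI_coeff:
  assumes "\<And>n. hcoeff f n = hcoeff g n" shows "f = g"
proof (rule hardy_eqI)
  fix z :: complex assume z: "norm z < 1"
  show "hfun f z = hfun g z"
    using sums_unique2[OF hfun_sums[OF z, of f]] hfun_sums[OF z, of g] assms by simp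
qed

instantiation hardy :: real_vector
begin
definition zero_hardy where "0 = Abs_hardy (\<lambda>z. 0)"
definition plus_hardy where "f + g = Abs_hardy (\<lambda>z. hfun f z + hfun g z)"
definition uminus_hardy where "- f = Abs_hardy (\<lambda>z. - hfun f z)"
definition minus_hardy where "f - g = f + (- g :: hardy)"
definition scaleR_hardy where "r *\<^sub>R f = Abs_hardy (\<lambda>z. of_real r * hfun f z)"

lemma hfun_zero [simp]: "hfun 0 = (\<lambda>z. 0)"
  by (simp add: zero_hardy_def Abs_hardy_inverse hardy_set_zero)
lemma hfun_add [simp]: "hfun (f + g) = (\<lambda>z. hfun f z + hfun g z)"
  by (simp add: plus_hardy_def Abs_hardy_inverse hardy_set_add hfun)
lemma hfun_uminus [simp]: "hfun (- f) = (\<lambda>z. - hfun f z)"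
  using hardy_set_cmult[OF hfun, of "-1" f] by (simp add: uminus_hardy_def Abs_hardy_inverse)
lemma hfun_minus [simp]: "hfun (f - g) = (\<lambda>z. hfun f z - hfun g z)"
  by (simp add: minus_hardy_def)
lemma hfun_scaleR [simp]: "hfun (r *\<^sub>R f) = (\<lambda>z. of_real r * hfun f z)"
  by (simp add: scaleR_hardy_def Abs_hardy_inverse hardy_set_cmult hfun)

instance
  by standard (rule hardy_eqI, simp add: algebra_simps)+
end

definition scaleC :: "complex \<Rightarrow> hardy \<Rightarrow> hardy" (infixr "*\<^sub>C" 75) where
  "c *\<^sub>C f = Abs_hardy (\<lambda>z. c * hfun f z)"

lemma hfun_scaleC [simp]: "hfun (c *\<^sub>C f) = (\<lambda>z. c * hfun f z)"
  by (simp add: scaleC_def Abs_hardy_inverse hardy_set_cmult hfun)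

global_interpretation hardy: vector_space scaleC
  by standard (rule hardy_eqI, simp add: algebra_simps)+

lemma scaleC_of_real: "of_real r *\<^sub>C f = r *\<^sub>R f"
  by (rule hardy_eqI) simp

lemma hcoeff_zero [simp]: "hcoeff 0 n = 0"
  using taylor_unique[of 1 "\<lambda>_. 0" "\<lambda>_. 0"] by (simp add: hcoeff_def)
lemma hcoeff_add [simp]: "hcoeff (f + g) n = hcoeff f n + hcoeff g n"
  by (simp add: hcoeff_def taylor_add[OF hfun_holomorphic hfun_holomorphic])
lemma hcoeff_scaleC [simp]: "hcoeff (c *\<^sub>C f) n = c * hcoeff f n"
  by (simp add: hcoeff_def taylor_cmult[OF hfun_holomorphic])
lemma hcoeff_scaleR [simp]: "hcoeff (r *\<^sub>R f) n = of_real r * hcoeff f n"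
  by (simp flip: scaleC_of_real)
lemma hcoeff_minus [simp]: "hcoeff (f - g) n = hcoeff f n - hcoeff g n"
  using hcoeff_add[of "f - g" g n] by simp

definition cinner :: "hardy \<Rightarrow> hardy \<Rightarrow> complex" where
  "cinner f g = (\<Sum>n. hcoeff f n * cnj (hcoeff g n))"

lemma cinner_sums: "(\<lambda>n. hcoeff f n * cnj (hcoeff g n)) sums cinner f g"
  unfolding cinner_def by (intro summable_sums l2_summable_mult_cnj hcoeff_l2)

lemma cinner_add_left: "cinner (f + g) h = cinner f h + cinner g h"
  using sums_unique2[OF cinner_sums[of "f + g" h]] sums_add[OF cinner_sums[of f h] cinner_sums[of g h]]
  by (simp add: algebra_simps)

lemma cinner_scaleC_left: "cinner (c *\<^sub>C f) h = c * cinner f h"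
  using sums_unique2[OF cinner_sums[of "c *\<^sub>C f" h]] sums_mult[OF cinner_sums[of f h], of c]
  by (simp add: algebra_simps)

lemma cinner_commute: "cinner f g = cnj (cinner g f)"
proof -
  have "(\<lambda>n. cnj (hcoeff g n * cnj (hcoeff f n))) sums cnj (cinner g f)"
    by (subst sums_cnj) (rule cinner_sums)
  then show ?thesis using sums_unique2[OF cinner_sums[of f g]] by (simp add: mult.commute)
qed

lemma cinner_self_sums: "(\<lambda>n. (norm (hcoeff f n))\<^sup>2) sums Re (cinner f f)"
  using sums_Re[OF cinner_sums[of f f]] by (simp add: complex_norm_square[symmetric] flip: of_real_power)

instantiation hardy :: real_inner
begin
definition inner_hardy where "inner f g = Re (cinner f g)"
definition norm_hardy where "norm f = sqrt (inner f (f :: hardy))"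
definition sgn_hardy where "sgn f = f /\<^sub>R norm (f :: hardy)"
definition dist_hardy where "dist f g = norm (f - g :: hardy)"
definition uniformity_hardy where
  "(uniformity :: (hardy \<times> hardy) filter) = (INF e\<in>{0 <..}. principal {(x, y). dist x y < e})"
definition open_hardy where
  "open (S :: hardy set) = (\<forall>x\<in>S. \<forall>\<^sub>F (x', y) in uniformity. x' = x \<longrightarrow> y \<in> S)"

instance
proof
  fix f g h :: hardy and r :: real
  show "inner f g = inner g f"
    unfolding inner_hardy_def by (subst cinner_commute) simp
  show "inner (f + g) h = inner f h + inner g h"
    by (simp add: inner_hardy_def cinner_add_left)
  show "inner (r *\<^sub>R f) g = r * inner f g"
    by (simp add: inner_hardy_def cinner_scaleC_left flip: scaleC_of_real)
  show "0 \<le> inner f f"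
    unfolding inner_hardy_def using sums_le[OF _ sums_zero cinner_self_sums[of f]] by simp
  show "inner f f = 0 \<longleftrightarrow> f = 0"
  proof
    assume "inner f f = 0"
    then have "(\<Sum>n. (norm (hcoeff f n))\<^sup>2) = 0"
      using cinner_self_sums[of f] by (simp add: inner_hardy_def sums_iff)
    then have "\<forall>n. (norm (hcoeff f n))\<^sup>2 = 0"
      by (subst (asm) suminf_eq_zero_iff) (auto intro: hcoeff_l2)
    then show "f = 0" by (intro hardy_eqI_coeff) simp
  next
    assume "f = 0" then show "inner f f = 0" by (simp add: inner_hardy_def cinner_def)
  qed
qed (simp_all add: norm_hardy_def sgn_hardy_def dist_hardy_def uniformity_hardy_def open_hardy_def)
end

lemma norm_hardy_sums: "(\<lambda>n. (norm (hcoeff f n))\<^sup>2) sums (norm f)\<^sup>2"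
  using cinner_self_sums[of f] by (simp add: power2_norm_eq_inner inner_hardy_def)

lemma norm_scaleC [simp]: "norm (c *\<^sub>C f) = norm c * norm f"
proof -
  have "(norm (c *\<^sub>C f))\<^sup>2 = (norm c * norm f)\<^sup>2"
    using sums_unique2[OF norm_hardy_sums[of "c *\<^sub>C f"]] sums_mult[OF norm_hardy_sums[of f], of "(norm c)\<^sup>2"]
    by (simp add: norm_mult power_mult_distrib)
  then show ?thesis by (simp add: power2_eq_iff_nonneg)
qed

lemma hardy_partial_le: "(\<Sum>n<N. (norm (hcoeff f n))\<^sup>2) \<le> (norm f)\<^sup>2"
  using sum_le_suminf[OF hcoeff_l2[of f], of "{..<N}"] norm_hardy_sums[of f] by (simp add: sums_iff)

lemma hcoeff_le_norm: "norm (hcoeff f n) \<le> norm f"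
proof -
  have "(norm (hcoeff f n))\<^sup>2 \<le> (\<Sum>n<Suc n. (norm (hcoeff f n))\<^sup>2)"
    by (simp add: sum_nonneg)
  also have "\<dots> \<le> (norm f)\<^sup>2" by (rule hardy_partial_le)
  finally show ?thesis by (rule power2_le_imp_le) simp
qed

instance hardy :: complete_space
proof
  fix X :: "nat \<Rightarrow> hardy" assume C: "Cauchy X"
  have cc: "Cauchy (\<lambda>k. hcoeff (X k) n)" for n
  proof (rule CauchyI)
    fix e :: real assume "e > 0"
    then obtain M where M: "\<forall>k\<ge>M. \<forall>l\<ge>M. norm (X k - X l) < e" using CauchyD[OF C] by blast
    show "\<exists>M. \<forall>k\<ge>M. \<forall>l\<ge>M. norm (hcoeff (X k) n - hcoeff (X l) n) < e"
      using M le_less_trans[OF hcoeff_le_norm[of "X _ - X _" n]] by (intro exI[of _ M]) auto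
  qed
  define c where "c n = lim (\<lambda>k. hcoeff (X k) n)" for n
  have lim: "(\<lambda>k. hcoeff (X k) n) \<longlonglongrightarrow> c n" for n
    using cc[of n] unfolding c_def by (simp add: Cauchy_convergent_iff convergent_LIMSEQ_iff)
  have part: "\<exists>M. \<forall>k\<ge>M. \<forall>N. (\<Sum>n<N. (norm (hcoeff (X k) n - c n))\<^sup>2) \<le> e\<^sup>2" if pos: "e > 0" for e :: real
  proof -
    obtain M where M: "\<forall>k\<ge>M. \<forall>l\<ge>M. norm (X k - X l) < e" using CauchyD[OF C pos] by blast
    have "(\<Sum>n<N. (norm (hcoeff (X k) n - c n))\<^sup>2) \<le> e\<^sup>2" if k: "k \<ge> M" for k N
    proof (rule LIMSEQ_le_const2)
      show "(\<lambda>l. \<Sum>n<N. (norm (hcoeff (X k) n - hcoeff (X l) n))\<^sup>2)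
             \<longlonglongrightarrow> (\<Sum>n<N. (norm (hcoeff (X k) n - c n))\<^sup>2)"
        by (intro tendsto_intros lim)
      have "(\<Sum>n<N. (norm (hcoeff (X k) n - hcoeff (X l) n))\<^sup>2) \<le> e\<^sup>2" if "l \<ge> M" for l
      proof -
        have "(\<Sum>n<N. (norm (hcoeff (X k - X l) n))\<^sup>2) \<le> (norm (X k - X l))\<^sup>2"
          by (rule hardy_partial_le)
        also have "\<dots> \<le> e\<^sup>2" using M k that by (intro power_mono) (auto intro: less_imp_le)
        finally show ?thesis by simp
      qed
      then show "\<exists>L. \<forall>l\<ge>L. (\<Sum>n<N. (norm (hcoeff (X k) n - hcoeff (X l) n))\<^sup>2) \<le> e\<^sup>2" by blast
    qed
    then show ?thesis by blast
  qed
  obtain M1 where M1: "\<forall>k\<ge>M1. \<forall>N. (\<Sum>n<N. (norm (hcoeff (X k) n - c n))\<^sup>2) \<le> 1\<^sup>2"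
    using part[of 1] by auto
  have d: "summable (\<lambda>n. (norm (hcoeff (X M1) n - c n))\<^sup>2)"
    by (rule summableI_nonneg_bounded[where x="1\<^sup>2"]) (use M1 in auto)
  have cl2: "summable (\<lambda>n. (norm (c n))\<^sup>2)"
    using l2_add[OF hcoeff_l2[of "X M1"] l2_cmult[OF d, of "-1"]] by simp
  define L where "L = Abs_hardy (\<lambda>z. if norm z < 1 then \<Sum>n. c n * z ^ n else 0)"
  have cL: "hcoeff L n = c n" for n
    unfolding hcoeff_def L_def
    by (simp add: Abs_hardy_inverse[OF hardy_set_of_seq(1)[OF cl2]] hardy_set_of_seq(2)[OF cl2])
  have "X \<longlonglongrightarrow> L"
  proof (rule LIMSEQ_I)
    fix e :: real assume e: "e > 0"
    obtain M where M: "\<forall>k\<ge>M. \<forall>N. (\<Sum>n<N. (norm (hcoeff (X k) n - c n))\<^sup>2) \<le> (e/2)\<^sup>2"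
      using part[of "e/2"] e by auto
    have "norm (X k - L) < e" if "k \<ge> M" for k
    proof -
      have "(norm (X k - L))\<^sup>2 \<le> (e/2)\<^sup>2"
        using suminf_le_const[OF hcoeff_l2[of "X k - L"], of "(e/2)\<^sup>2"] norm_hardy_sums[of "X k - L"] M that
        by (simp add: sums_iff cL)
      then have "norm (X k - L) \<le> e/2" by (rule power2_le_imp_le) (use e in simp)
      then show ?thesis using e by simp
    qed
    then show "\<exists>M. \<forall>k\<ge>M. norm (X k - L) < e" by blast
  qed
  then show "convergent X" by (auto simp: convergent_def)
qed

instance hardy :: banach ..

lemma bounded_linear_hfun:
  assumes "norm z < 1" shows "bounded_linear (\<lambda>f. hfun f z)"
proof (rule bounded_linear_intro[where K="\<Sum>n. norm z ^ n"])
  fix f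
  have sz: "summable (\<lambda>n. norm z ^ n)" using assms by (simp add: summable_geometric)
  have le: "norm (hcoeff f n * z ^ n) \<le> norm f * norm z ^ n" for n
    by (simp add: norm_mult norm_power mult_right_mono hcoeff_le_norm)
  have s2: "summable (\<lambda>n. norm (hcoeff f n * z ^ n))" by (rule l2_power_sums[OF hcoeff_l2 assms])
  have "norm (hfun f z) \<le> (\<Sum>n. norm (hcoeff f n * z ^ n))"
    using summable_norm[OF s2] hfun_sums[OF assms, of f] by (simp add: sums_iff)
  also have "\<dots> \<le> (\<Sum>n. norm f * norm z ^ n)"
    by (intro suminf_le le s2 summable_mult sz)
  also have "\<dots> = norm f * (\<Sum>n. norm z ^ n)" by (rule suminf_mult[OF sz])
  finally show "norm (hfun f z) \<le> norm f * (\<Sum>n. norm z ^ n)" .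
qed (simp_all add: scaleR_conv_of_real)

section \<open>Composition with the involutive automorphisms of the disk\<close>

definition disk_inv :: "complex \<Rightarrow> complex \<Rightarrow> complex" where
  "disk_inv a z = (a - z) / (1 - cnj a * z)"

lemma disk_inv_Moebius: "disk_inv a z = - Moebius_function 0 a z"
  by (simp add: disk_inv_def Moebius_function_def minus_divide_left)

lemma norm_disk_inv_less: "norm a < 1 \<Longrightarrow> norm z < 1 \<Longrightarrow> norm (disk_inv a z) < 1"
  by (simp add: disk_inv_Moebius Moebius_function_norm_lt_1)

text \<open>The rest of this section shows that $f \circ \varphi_a$ belongs to $H^2$ whenever $f$ does.\<close>

lemma taylor_times_z:
  assumes "H holomorphic_on ball 0 r" "r > 0"
  shows "taylor (\<lambda>z. z * H z) n = (case n of 0 \<Rightarrow> 0 | Suc m \<Rightarrow> taylor H m)"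
proof (rule taylor_unique[OF assms(2)])
  fix z :: complex assume z: "norm z < r"
  have "(\<lambda>n. (case Suc n of 0 \<Rightarrow> 0 | Suc m \<Rightarrow> taylor H m) * z ^ Suc n) sums (z * H z)"
    using sums_mult[OF taylor_sums[OF assms(1) z], of z] by (simp add: algebra_simps)
  from sums_Suc[OF this]
  show "(\<lambda>n. (case n of 0 \<Rightarrow> 0 | Suc m \<Rightarrow> taylor H m) * z ^ n) sums (z * H z)" by simp
qed

lemma taylor_times_affine:
  assumes "H holomorphic_on ball 0 r" "r > 0"
  shows "taylor (\<lambda>z. (p + q * z) * H z) n = p * taylor H n + q * (case n of 0 \<Rightarrow> 0 | Suc m \<Rightarrow> taylor H m)"
proof -
  have hz: "(\<lambda>z. z * H z) holomorphic_on ball 0 r" by (intro holomorphic_intros assms)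
  have "taylor (\<lambda>z. p * H z + q * (z * H z)) n = p * taylor H n + q * taylor (\<lambda>z. z * H z) n"
    by (subst taylor_add[where r=r])
       (auto intro!: holomorphic_intros assms simp: taylor_cmult[OF hz assms(2)] taylor_cmult[OF assms])
  then show ?thesis by (simp add: taylor_times_z[OF assms] algebra_simps)
qed

lemma taylor_abs_summable:
  assumes "F holomorphic_on ball 0 r" "r > 1"
  shows "summable (\<lambda>n. norm (taylor F n))"
proof -
  have "norm (of_real ((1 + r) / 2) :: complex) = (1 + r) / 2"
    using assms(2) by (simp only: norm_of_real) simp
  then have "summable (\<lambda>n. taylor F n * (of_real ((1 + r) / 2)) ^ n)"
    using taylor_sums[OF assms(1), of "of_real ((1 + r) / 2)"] assms(2) by (simp add: sums_iff)
  from powser_insidea[OF this, of 1] show ?thesis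
    using assms(2) \<open>norm (of_real ((1 + r) / 2) :: complex) = (1 + r) / 2\<close> by simp
qed

lemmas taylor_l2 = taylor_abs_summable[THEN l1_imp_l2]

definition taylor_ip :: "(complex \<Rightarrow> complex) \<Rightarrow> (complex \<Rightarrow> complex) \<Rightarrow> complex" where
  "taylor_ip F G = (\<Sum>n. taylor F n * cnj (taylor G n))"

lemma taylor_ip_sums:
  assumes "F holomorphic_on ball 0 r" "G holomorphic_on ball 0 r" "r > 1"
  shows "(\<lambda>n. taylor F n * cnj (taylor G n)) sums taylor_ip F G"
  unfolding taylor_ip_def
  by (intro summable_sums l2_summable_mult_cnj taylor_l2[OF assms(1,3)] taylor_l2[OF assms(2,3)])

lemma taylor_ip_commute:
  assumes "F holomorphic_on ball 0 r" "G holomorphic_on ball 0 r" "r > 1"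
  shows "taylor_ip G F = cnj (taylor_ip F G)"
proof -
  have "(\<lambda>n. cnj (taylor F n * cnj (taylor G n))) sums cnj (taylor_ip F G)"
    by (subst sums_cnj) (rule taylor_ip_sums[OF assms])
  then show ?thesis
    using sums_unique2[OF taylor_ip_sums[OF assms(2,1,3)]] by (simp add: mult.commute)
qed

context
  fixes a :: complex and R :: real
  assumes a: "norm a < 1"
  defines "R \<equiv> 2 / (1 + norm a)"
begin

lemma R_gt_1: "R > 1"
  using a by (simp add: R_def field_simps add_pos_nonneg)

lemma disk_inv_denom_nonzero:
  assumes "norm z < R" shows "1 - cnj a * z \<noteq> 0"
proof
  assume "1 - cnj a * z = 0"
  then have eq: "norm a * norm z = 1" by (metis complex_mod_cnj eq_iff_diff_eq_0 norm_mult norm_one)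
  have "norm z * (1 + norm a) < 2"
    using assms by (simp add: R_def pos_less_divide_eq add_pos_nonneg)
  then have "norm z < 1" using eq by (simp add: algebra_simps)
  then have "norm a * norm z < 1"
    using a mult_strict_mono'[of "norm a" 1 "norm z" 1] by simp
  then show False using eq by simp
qed

lemma holomorphic_disk_inv: "disk_inv a holomorphic_on ball 0 R"
  unfolding disk_inv_def[abs_def]
  by (intro holomorphic_intros) (use disk_inv_denom_nonzero in auto)

lemma taylor_ip_disk_inv:
  assumes F: "F holomorphic_on ball 0 R" and G: "G holomorphic_on ball 0 R"
  shows "taylor_ip (\<lambda>z. disk_inv a z * F z) (\<lambda>z. disk_inv a z * G z) = taylor_ip F G"
proof -
  have R0: "R > 0" using R_gt_1 by simp
  define q where "q K z = K z / (1 - cnj a * z)" for K :: "complex \<Rightarrow> complex" and z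
  have hq: "q K holomorphic_on ball 0 R" if "K holomorphic_on ball 0 R" for K
    unfolding q_def[abs_def] by (intro holomorphic_intros that) (use disk_inv_denom_nonzero in auto)
  define S where "S K n = (case n of 0 \<Rightarrow> 0 | Suc m \<Rightarrow> taylor (q K) m)" for K and n :: nat
  have t1: "taylor K n = taylor (q K) n - cnj a * S K n" if K: "K holomorphic_on ball 0 R" for K n
  proof -
    have "taylor (\<lambda>z. (1 + (- cnj a) * z) * q K z) n = 1 * taylor (q K) n + (- cnj a) * S K n"
      unfolding S_def by (rule taylor_times_affine[OF hq[OF K] R0])
    moreover have "taylor (\<lambda>z. (1 + (- cnj a) * z) * q K z) n = taylor K n"
      by (rule taylor_cong[OF K R0]) (use disk_inv_denom_nonzero in \<open>auto simp: q_def\<close>)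
    ultimately show ?thesis by simp
  qed
  have t2: "taylor (\<lambda>z. disk_inv a z * K z) n = a * taylor (q K) n - S K n"
    if K: "K holomorphic_on ball 0 R" for K n
  proof -
    have "taylor (\<lambda>z. (a + (- 1) * z) * q K z) n = a * taylor (q K) n + (- 1) * S K n"
      unfolding S_def by (rule taylor_times_affine[OF hq[OF K] R0])
    moreover have "(\<lambda>z. (a + (- 1) * z) * q K z) = (\<lambda>z. disk_inv a z * K z)"
      by (simp add: q_def disk_inv_def)
    ultimately show ?thesis by simp
  qed
  have u: "(\<lambda>n. taylor (q F) n * cnj (taylor (q G) n)) sums taylor_ip (q F) (q G)"
    by (rule taylor_ip_sums[OF hq[OF F] hq[OF G] R_gt_1])
  have v: "(\<lambda>n. S F n * cnj (S G n)) sums taylor_ip (q F) (q G)"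
    using sums_Suc[of "\<lambda>n. S F n * cnj (S G n)"] u by (simp add: S_def)
  have "(\<lambda>n. (a * cnj a - 1) * (taylor (q F) n * cnj (taylor (q G) n) - S F n * cnj (S G n))) sums 0"
    using sums_mult[OF sums_diff[OF u v], of "a * cnj a - 1"] by simp
  from sums_add[OF this taylor_ip_sums[OF F G R_gt_1]]
  have "(\<lambda>n. (a * taylor (q F) n - S F n) * cnj (a * taylor (q G) n - S G n)) sums taylor_ip F G"
    by (simp add: t1[OF F] t1[OF G] algebra_simps)
  then have "(\<lambda>n. taylor (\<lambda>z. disk_inv a z * F z) n * cnj (taylor (\<lambda>z. disk_inv a z * G z) n)) sums taylor_ip F G"
    by (simp only: t2[OF F] t2[OF G])
  then show ?thesis unfolding taylor_ip_def by (simp add: sums_iff)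
qed

lemma holomorphic_disk_inv_power: "(\<lambda>z. disk_inv a z ^ n) holomorphic_on ball 0 R"
  by (intro holomorphic_intros holomorphic_disk_inv)

lemma taylor_ip_powers:
  "taylor_ip (\<lambda>z. disk_inv a z ^ (k + m)) (\<lambda>z. disk_inv a z ^ m) = a ^ k"
proof (induction m)
  case 0
  have R0: "R > 0" using R_gt_1 by simp
  have one: "taylor (\<lambda>z. 1) n = (if n = 0 then 1 else 0)" for n
    by (simp add: taylor_def)
  have "taylor_ip (\<lambda>z. disk_inv a z ^ k) (\<lambda>z. 1) = taylor (\<lambda>z. disk_inv a z ^ k) 0"
    unfolding taylor_ip_def by (subst suminf_finite[of "{0}"]) (auto simp: one)
  then show ?case by (simp add: taylor_def disk_inv_def)
next
  case (Suc m)
  show ?case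
    using taylor_ip_disk_inv[OF holomorphic_disk_inv_power[of "k + m"] holomorphic_disk_inv_power[of m]] Suc
    by simp
qed

lemma norm_taylor_ip_powers:
  "norm (taylor_ip (\<lambda>z. disk_inv a z ^ n) (\<lambda>z. disk_inv a z ^ m)) = norm a ^ ((n - m) + (m - n))"
proof (cases "m \<le> n")
  case True
  then show ?thesis using taylor_ip_powers[of "n - m" m] by (simp add: norm_power)
next
  case False
  then show ?thesis
    using taylor_ip_powers[of "m - n" n]
      taylor_ip_commute[OF holomorphic_disk_inv_power[of m] holomorphic_disk_inv_power[of n] R_gt_1]
    by (simp add: norm_power)
qed

lemma sum_power_dist_le: "(\<Sum>m<N. norm a ^ ((n - m) + (m - n))) \<le> 2 / (1 - norm a)"
proof -
  let ?r = "norm a"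
  have sm: "summable (\<lambda>j. ?r ^ j)" using a by (simp add: summable_geometric)
  have fin: "(\<Sum>j\<in>J. ?r ^ j) \<le> 1 / (1 - ?r)" if "finite J" for J
    using sum_le_suminf[OF sm that] a by (simp add: suminf_geometric)
  have "(\<Sum>m<N. ?r ^ ((n - m) + (m - n)))
        \<le> (\<Sum>m\<in>{..n} \<union> {n..<N}. ?r ^ ((n - m) + (m - n)))"
    by (intro sum_mono2) auto
  also have "\<dots> \<le> (\<Sum>m\<in>{..n}. ?r ^ ((n - m) + (m - n))) + (\<Sum>m\<in>{n..<N}. ?r ^ ((n - m) + (m - n)))"
    using sum_nonneg[of "{..n} \<inter> {n..<N}" "\<lambda>m. ?r ^ ((n - m) + (m - n))"]
    by (simp add: sum_Un)
  also have "(\<Sum>m\<in>{..n}. ?r ^ ((n - m) + (m - n))) = (\<Sum>j\<in>(\<lambda>m. n - m) ` {..n}. ?r ^ j)"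
    by (subst sum.reindex) (auto simp: inj_on_def intro!: sum.cong)
  also have "\<dots> \<le> 1 / (1 - ?r)" by (rule fin) simp
  also have "(\<Sum>m\<in>{n..<N}. ?r ^ ((n - m) + (m - n))) = (\<Sum>j\<in>(\<lambda>m. m - n) ` {n..<N}. ?r ^ j)"
    by (subst sum.reindex) (auto simp: inj_on_def intro!: sum.cong)
  also have "\<dots> \<le> 1 / (1 - ?r)" by (rule fin) simp
  finally show ?thesis by simp
qed

lemma disk_inv_poly_bound:
  fixes b :: "nat \<Rightarrow> complex"
  shows "(\<Sum>k<K. (norm (taylor (\<lambda>z. \<Sum>n<N. b n * disk_inv a z ^ n) k))\<^sup>2)
          \<le> 2 / (1 - norm a) * (\<Sum>n<N. (norm (b n))\<^sup>2)"
proof -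
  have R0: "R > 0" using R_gt_1 by simp
  define P where "P n = (\<lambda>z. disk_inv a z ^ n)" for n
  have hP: "P n holomorphic_on ball 0 R" for n unfolding P_def by (rule holomorphic_disk_inv_power)
  define F where "F = (\<lambda>z. \<Sum>n<N. b n * P n z)"
  have hF: "F holomorphic_on ball 0 R" unfolding F_def by (intro holomorphic_intros hP)
  have tF: "taylor F k = (\<Sum>n<N. b n * taylor (P n) k)" for k
    unfolding F_def using R0
    by (subst taylor_sum[where r=R]) (auto intro!: holomorphic_intros hP simp: taylor_cmult[OF hP])
  define D where "D n m = norm a ^ ((n - m) + (m - n))" for n m :: nat
  have "(\<lambda>k. \<Sum>n<N. \<Sum>m<N. b n * cnj (b m) * (taylor (P n) k * cnj (taylor (P m) k))) sums
          (\<Sum>n<N. \<Sum>m<N. b n * cnj (b m) * taylor_ip (P n) (P m))"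
    by (intro sums_sum sums_mult taylor_ip_sums[OF hP hP R_gt_1])
  moreover have "(\<Sum>n<N. \<Sum>m<N. b n * cnj (b m) * (taylor (P n) k * cnj (taylor (P m) k)))
                 = of_real ((norm (taylor F k))\<^sup>2)" for k
    unfolding complex_norm_square tF by (simp add: sum_product algebra_simps)
  ultimately have sq: "(\<lambda>k. (norm (taylor F k))\<^sup>2) sums
      Re (\<Sum>n<N. \<Sum>m<N. b n * cnj (b m) * taylor_ip (P n) (P m))"
    using sums_Re by fastforce
  have "(\<Sum>k<K. (norm (taylor F k))\<^sup>2) \<le> Re (\<Sum>n<N. \<Sum>m<N. b n * cnj (b m) * taylor_ip (P n) (P m))"
    using sum_le_suminf[of "\<lambda>k. (norm (taylor F k))\<^sup>2" "{..<K}"] sq by (simp add: sums_iff)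
  also have "\<dots> \<le> norm (\<Sum>n<N. \<Sum>m<N. b n * cnj (b m) * taylor_ip (P n) (P m))"
    by (rule complex_Re_le_cmod)
  also have "\<dots> \<le> (\<Sum>n<N. \<Sum>m<N. norm (b n) * norm (b m) * D n m)"
    by (intro sum_norm_le order.refl) 
       (simp add: norm_mult D_def P_def norm_taylor_ip_powers)
  also have "\<dots> \<le> (\<Sum>n<N. \<Sum>m<N. (norm (b n))\<^sup>2 / 2 * D n m + (norm (b m))\<^sup>2 / 2 * D n m)"
  proof (intro sum_mono)
    fix n m
    have "norm (b n) * norm (b m) \<le> (norm (b n))\<^sup>2 / 2 + (norm (b m))\<^sup>2 / 2"
      using sum_squares_bound[of "norm (b n)" "norm (b m)"] by simp
    then have "norm (b n) * norm (b m) * D n m \<le> ((norm (b n))\<^sup>2 / 2 + (norm (b m))\<^sup>2 / 2) * D n m"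
      by (rule mult_right_mono) (simp add: D_def)
    then show "norm (b n) * norm (b m) * D n m \<le> (norm (b n))\<^sup>2 / 2 * D n m + (norm (b m))\<^sup>2 / 2 * D n m"
      by (simp add: algebra_simps)
  qed
  also have "\<dots> = (\<Sum>n<N. \<Sum>m<N. (norm (b n))\<^sup>2 / 2 * D n m) + (\<Sum>n<N. \<Sum>m<N. (norm (b m))\<^sup>2 / 2 * D n m)"
    by (simp add: sum.distrib)
  also have "(\<Sum>n<N. \<Sum>m<N. (norm (b m))\<^sup>2 / 2 * D n m) = (\<Sum>n<N. \<Sum>m<N. (norm (b n))\<^sup>2 / 2 * D n m)"
    by (subst sum.swap) (simp add: D_def add.commute)
  also have "(\<Sum>n<N. \<Sum>m<N. (norm (b n))\<^sup>2 / 2 * D n m) + (\<Sum>n<N. \<Sum>m<N. (norm (b n))\<^sup>2 / 2 * D n m)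
             = (\<Sum>n<N. (norm (b n))\<^sup>2 * (\<Sum>m<N. D n m))"
    by (simp add: sum_distrib_left flip: sum.distrib) (simp add: field_simps)
  also have "\<dots> \<le> (\<Sum>n<N. (norm (b n))\<^sup>2 * (2 / (1 - norm a)))"
    unfolding D_def by (intro sum_mono mult_left_mono sum_power_dist_le) simp
  also have "\<dots> = 2 / (1 - norm a) * (\<Sum>n<N. (norm (b n))\<^sup>2)"
    by (simp add: sum_distrib_left mult.commute)
  finally show ?thesis by (simp add: F_def P_def)
qed

lemma taylor_comp_l2:
  "summable (\<lambda>k. (norm (taylor (\<lambda>z. hfun f (disk_inv a z)) k))\<^sup>2)"
proof -
  let ?b = "hcoeff f"
  define p where "p N z = (\<Sum>n<N. ?b n * disk_inv a z ^ n)" for N z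
  have sub: "ball 0 (1/2) \<subseteq> ball 0 R" "cball 0 (1/2) \<subseteq> ball 0 R" using R_gt_1 by auto
  have "continuous_on (cball 0 (1/2)) (\<lambda>z. norm (disk_inv a z))"
    using holomorphic_disk_inv[THEN holomorphic_on_imp_continuous_on] sub(2)
    by (intro continuous_intros) (rule continuous_on_subset)
  from continuous_attains_sup[OF _ _ this]
  obtain z0 where z0: "z0 \<in> cball 0 (1/2)" "\<forall>z\<in>cball 0 (1/2). norm (disk_inv a z) \<le> norm (disk_inv a z0)"
    by auto
  define \<rho> where "\<rho> = norm (disk_inv a z0)"
  have \<rho>: "\<rho> < 1" unfolding \<rho>_def using z0(1) by (intro norm_disk_inv_less a) auto
  have sm: "summable (\<lambda>n. norm (?b n * of_real \<rho> ^ n))"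
    by (rule l2_power_sums[OF hcoeff_l2]) (use \<rho> in \<open>simp add: \<rho>_def\<close>)
  have "uniform_limit (ball 0 (1/2)) p (\<lambda>z. \<Sum>n. ?b n * disk_inv a z ^ n) sequentially"
    unfolding p_def
  proof (rule Weierstrass_m_test[OF _ sm])
    fix n and z :: complex assume "z \<in> ball 0 (1/2)"
    then have "norm (disk_inv a z) \<le> \<rho>" using z0(2) by (auto simp: \<rho>_def)
    then show "norm (?b n * disk_inv a z ^ n) \<le> norm (?b n * of_real \<rho> ^ n)"
      by (simp add: norm_mult norm_power mult_left_mono power_mono \<rho>_def)
  qed
  also have "?this \<longleftrightarrow> uniform_limit (ball 0 (1/2)) p (\<lambda>z. hfun f (disk_inv a z)) sequentially"
  proof (rule uniform_limit_cong')
    fix z :: complex assume "z \<in> ball 0 (1/2)"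
    then have "norm (disk_inv a z) < 1" by (intro norm_disk_inv_less a) auto
    from hfun_sums[OF this, of f] show "(\<Sum>n. ?b n * disk_inv a z ^ n) = hfun f (disk_inv a z)"
      by (simp add: sums_iff)
  qed simp
  finally have ul: "uniform_limit (ball 0 (1/2)) p (\<lambda>z. hfun f (disk_inv a z)) sequentially" .
  have lim: "(\<lambda>N. taylor (p N) k) \<longlonglongrightarrow> taylor (\<lambda>z. hfun f (disk_inv a z)) k" for k
    unfolding taylor_def
    by (intro tendsto_divide tendsto_const higher_deriv_complex_uniform_limit[OF ul])
       (auto simp: p_def[abs_def] intro!: always_eventually holomorphic_intros 
          holomorphic_on_subset[OF holomorphic_disk_inv sub(1)])
  show ?thesis
  proof (rule summableI_nonneg_bounded[where x="2 / (1 - norm a) * (norm f)\<^sup>2"])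
    fix K
    show "(\<Sum>k<K. (norm (taylor (\<lambda>z. hfun f (disk_inv a z)) k))\<^sup>2) \<le> 2 / (1 - norm a) * (norm f)\<^sup>2"
    proof (rule LIMSEQ_le_const2)
      show "(\<lambda>N. \<Sum>k<K. (norm (taylor (p N) k))\<^sup>2)
            \<longlonglongrightarrow> (\<Sum>k<K. (norm (taylor (\<lambda>z. hfun f (disk_inv a z)) k))\<^sup>2)"
        by (intro tendsto_intros lim)
      have "(\<Sum>k<K. (norm (taylor (p N) k))\<^sup>2) \<le> 2 / (1 - norm a) * (norm f)\<^sup>2" for N
        using order_trans[OF disk_inv_poly_bound mult_left_mono[OF hardy_partial_le]] a
        unfolding p_def by simp
      then show "\<exists>N. \<forall>n\<ge>N. (\<Sum>k<K. (norm (taylor (p n) k))\<^sup>2) \<le> 2 / (1 - norm a) * (norm f)\<^sup>2"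
        by blast
    qed
  qed simp
qed

lemma comp_in_hardy_set: "(\<lambda>z. if norm z < 1 then hfun f (disk_inv a z) else 0) \<in> hardy_set"
proof -
  have "disk_inv a holomorphic_on ball 0 1"
    by (rule holomorphic_on_subset[OF holomorphic_disk_inv]) (use R_gt_1 in auto)
  moreover have "disk_inv a ` ball 0 1 \<subseteq> ball 0 1"
    using norm_disk_inv_less[OF a] by auto
  ultimately have h: "(\<lambda>z. hfun f (disk_inv a z)) holomorphic_on ball 0 1"
    using holomorphic_on_compose_gen[OF _ hfun_holomorphic] by (auto simp: o_def)
  have t: "taylor (\<lambda>z. if norm z < 1 then hfun f (disk_inv a z) else 0) n
        = taylor (\<lambda>z. hfun f (disk_inv a z)) n" for n
    by (rule taylor_cong[OF h]) auto
  have "(\<lambda>z. if norm z < 1 then hfun f (disk_inv a z) else 0) holomorphic_on ball 0 1"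
    by (rule holomorphic_transform[OF h]) simp
  then show ?thesis using taylor_comp_l2[of f] by (simp add: hardy_set_def t)
qed

end

text \<open>The operator $C_a f = f \circ \varphi_a$ on $H^2$; it is meaningful for \<^term>\<open>norm a < 1\<close> only.\<close>

definition comp_op :: "complex \<Rightarrow> hardy \<Rightarrow> hardy" where
  "comp_op a f = Abs_hardy (\<lambda>z. if norm z < 1 then hfun f (disk_inv a z) else 0)"

lemma hfun_comp_op:
  assumes "norm a < 1" "norm z < 1"
  shows "hfun (comp_op a f) z = hfun f (disk_inv a z)"
  unfolding comp_op_def by (subst Abs_hardy_inverse[OF comp_in_hardy_set[OF assms(1)]]) (simp add: assms(2))

section \<open>Operators, closed subspaces and geodesics\<close>

definition nullspace :: "(hardy \<Rightarrow> hardy) \<Rightarrow> hardy set" where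
  "nullspace A = {f. A f = 0}"

definition grassmannian :: "hardy set set" where
  "grassmannian = {S. hardy.subspace S \<and> closed S}"

definition bounded_operator :: "(hardy \<Rightarrow> hardy) \<Rightarrow> bool" where
  "bounded_operator A \<longleftrightarrow> Vector_Spaces.linear scaleC scaleC A \<and> (\<exists>K. \<forall>f. norm (A f) \<le> K * norm f)"

definition selfadjoint :: "(hardy \<Rightarrow> hardy) \<Rightarrow> bool" where
  "selfadjoint A \<longleftrightarrow> (\<forall>f g. cinner (A f) g = cinner f (A g))"

definition ortho_compl :: "hardy set \<Rightarrow> hardy set" where
  "ortho_compl S = {f. \<forall>g\<in>S. cinner f g = 0}"

definition codiagonal :: "(hardy \<Rightarrow> hardy) \<Rightarrow> hardy set \<Rightarrow> bool" where
  "codiagonal A S \<longleftrightarrow> A ` S \<subseteq> ortho_compl S \<and> A ` ortho_compl S \<subseteq> S"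

definition op_exp :: "(hardy \<Rightarrow> hardy) \<Rightarrow> hardy \<Rightarrow> hardy" where
  "op_exp A f = (\<Sum>n. (A ^^ n) f /\<^sub>R fact n)"

lemma op_exp_sums:
  assumes "bounded_operator A"
  shows "(\<lambda>n. (A ^^ n) f /\<^sub>R fact n) sums op_exp A f"
proof -
  obtain K where "\<And>f. norm (A f) \<le> K * norm f" using assms by (auto simp: bounded_operator_def)
  then have K: "norm (A f) \<le> \<bar>K\<bar> * norm f" for f
    by (rule order_trans) (simp add: mult_right_mono)
  have pw: "norm ((A ^^ n) f) \<le> \<bar>K\<bar> ^ n * norm f" for n
  proof (induction n)
    case (Suc n)
    have "norm (A ((A ^^ n) f)) \<le> \<bar>K\<bar> * (\<bar>K\<bar> ^ n * norm f)"
      by (rule order_trans[OF K mult_left_mono[OF Suc]]) simp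
    then show ?case by simp
  qed simp
  have "summable (\<lambda>n. (A ^^ n) f /\<^sub>R fact n)"
  proof (rule summable_comparison_test'[where N=0])
    show "summable (\<lambda>n. \<bar>K\<bar> ^ n /\<^sub>R fact n * norm f)"
      by (intro summable_mult2 summable_exp_generic)
    show "norm ((A ^^ n) f /\<^sub>R fact n) \<le> \<bar>K\<bar> ^ n /\<^sub>R fact n * norm f" for n
      using pw[of n] by (simp add: divide_simps)
  qed
  then show ?thesis by (simp add: op_exp_def summable_sums)
qed

text \<open>
  Only the values of \<open>\<delta>\<close> on the unit interval are constrained.
\<close>

definition geodesic_joining :: "(real \<Rightarrow> hardy set) \<Rightarrow> hardy set \<Rightarrow> hardy set \<Rightarrow> bool" where
  "geodesic_joining \<delta> S T \<longleftrightarrow> S \<in> grassmannian \<and> T \<in> grassmannian \<and>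
     (\<exists>X. bounded_operator X \<and> selfadjoint X \<and> codiagonal X S \<and> codiagonal X T \<and>
          (\<forall>t\<in>{0..1}. \<delta> t = op_exp (\<lambda>f. (\<i> * of_real t) *\<^sub>C X f) ` S)) \<and> \<delta> 1 = T"

lemma nullspace_comp_op:
  assumes "norm a < 1"
  shows "nullspace (\<lambda>f. comp_op a f + f) = {f. \<forall>z. norm z < 1 \<longrightarrow> hfun f (disk_inv a z) = - hfun f z}"
    and "nullspace (\<lambda>f. comp_op a f - f) = {f. \<forall>z. norm z < 1 \<longrightarrow> hfun f (disk_inv a z) = hfun f z}"
proof -
  have *: "comp_op a f = c *\<^sub>C f \<longleftrightarrow> (\<forall>z. norm z < 1 \<longrightarrow> hfun f (disk_inv a z) = c * hfun f z)" for f c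
    using hfun_comp_op[OF assms, of _ f] hardy_eqI[of "comp_op a f" "c *\<^sub>C f"] by fastforce
  show "nullspace (\<lambda>f. comp_op a f + f) = {f. \<forall>z. norm z < 1 \<longrightarrow> hfun f (disk_inv a z) = - hfun f z}"
    using *[of _ "-1"] by (auto simp: nullspace_def eq_neg_iff_add_eq_0[symmetric] hardy.scale_minus_left)
  show "nullspace (\<lambda>f. comp_op a f - f) = {f. \<forall>z. norm z < 1 \<longrightarrow> hfun f (disk_inv a z) = hfun f z}"
    using *[of _ 1] by (auto simp: nullspace_def)
qed

text \<open>So the membership clauses of \<^const>\<open>geodesic_joining\<close> hold for these two nullspaces.\<close>

lemma nullspace_comp_op_grassmannian:
  assumes "norm a < 1"
  shows "nullspace (\<lambda>f. comp_op a f + f) \<in> grassmannian"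
    and "nullspace (\<lambda>f. comp_op a f - f) \<in> grassmannian"
proof -
  have cl: "closed {f. \<forall>z. norm z < 1 \<longrightarrow> hfun f (disk_inv a z) = c * hfun f z}" for c
  proof (intro closed_Collect_all)
    fix z :: complex
    show "closed {f. norm z < 1 \<longrightarrow> hfun f (disk_inv a z) = c * hfun f z}"
    proof (cases "norm z < 1")
      case True
      have "continuous_on UNIV (\<lambda>f. hfun f w)" if "norm w < 1" for w
        by (rule linear_continuous_on[OF bounded_linear_hfun[OF that]])
      then show ?thesis
        using True norm_disk_inv_less[OF assms True]
        by (auto intro!: closed_Collect_eq continuous_on_mult_left)
    qed simp
  qed
  have "closed {f. \<forall>z. norm z < 1 \<longrightarrow> hfun f (disk_inv a z) = - hfun f z}"
    using cl[of "-1"] by simp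
  then show "nullspace (\<lambda>f. comp_op a f + f) \<in> grassmannian"
    unfolding grassmannian_def nullspace_comp_op[OF assms] hardy.subspace_def by simp
  have "closed {f. \<forall>z. norm z < 1 \<longrightarrow> hfun f (disk_inv a z) = hfun f z}"
    using cl[of 1] by simp
  then show "nullspace (\<lambda>f. comp_op a f - f) \<in> grassmannian"
    unfolding grassmannian_def nullspace_comp_op[OF assms] hardy.subspace_def by simp
qed

end

theory Submission
  imports Defs
begin

text \<open>
  Let \<open>S = N(C\<^sub>0 + I)\<close>, the odd functions, and \<open>T = N(C\<^sub>a - I)\<close>.  The constant function 1 is a nonzero
  element of \<open>S\<^sup>\<bottom> \<inter> T\<close>, whereas \<open>S \<inter> T\<^sup>\<bottom>\<close> is trivial, which rules out a geodesic.

  Suppose that \<open>X\<close> is the exponent of a geodesic.  Codiagonality sends \<open>f \<in> S\<^sup>\<bottom> \<inter> T\<close> to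
  \<open>X f \<in> S \<inter> T\<^sup>\<bottom>\<close>.  If the latter space is trivial, then \<open>X f = 0\<close>, so \<open>e\<^sup>i\<^sup>X\<close> does not change inner
  products with \<open>f\<close>.  Since \<open>f = e\<^sup>i\<^sup>X s\<close> with \<open>s \<in> S\<close>, it follows that
  \<open>\<langle>f, f\<rangle> = \<langle>s, f\<rangle> = 0\<close> (lemma \<open>geodesic_ortho_compl_Int_trivial\<close>).

  Now let \<open>f \<in> S \<inter> T\<^sup>\<bottom>\<close>.  Testing \<open>f\<close> against the elements \<open>k\<^sub>w + C\<^sub>a k\<^sub>w\<close> of \<open>T\<close>, with \<open>k\<^sub>w\<close> the
  reproducing kernel, shows that \<open>(a - w) f(w)\<close> is invariant under \<open>\<phi>\<^sub>a\<close>
  (lemma \<open>ortho_invariant_imp_functional_eq\<close>).  Because \<open>f\<close> is odd, this says that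
  \<open>f(z) dz / z\<close> is invariant under the hyperbolic automorphism \<open>\<psi>(z) = \<phi>\<^sub>a(-z)\<close>.  By the invariance of
  \<open>|dz| / (1 - |z|\<^sup>2)\<close>, the quantity \<open>(1 - |z|\<^sup>2) |f(z)| / |z|\<close> is constant on the orbits of \<open>\<psi>\<close>.
  The orbits on the radius through \<open>a\<close> converge to the circle, where the growth estimate
  \<open>|f(z)|\<^sup>2 (1 - |z|\<^sup>2) \<le> \<parallel>f\<parallel>\<^sup>2\<close> forces that quantity to tend to 0.  Hence \<open>f\<close> vanishes on the radius
  beyond \<open>a\<close>, and everywhere by the identity theorem (lemma \<open>odd_functional_eq_imp_zero\<close>).
\<close>

section \<open>The inner product\<close>

lemma cinner_add_right: "cinner f (g + h) = cinner f g + cinner f h"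
  using cinner_add_left[of g h f] by (metis cinner_commute complex_cnj_add)

lemma cinner_scaleC_right: "cinner f (c *\<^sub>C g) = cnj c * cinner f g"
  using cinner_scaleC_left[of c g f] by (metis cinner_commute complex_cnj_mult)

lemma cinner_self_eq_0_iff: "cinner f f = 0 \<longleftrightarrow> f = 0"
proof
  assume "cinner f f = 0"
  then have "inner f f = 0" by (simp add: inner_hardy_def)
  then show "f = 0" by simp
qed (simp add: cinner_def)

lemma norm_cinner_le: "norm (cinner f g) \<le> norm f * norm g"
proof (cases "cinner f g = 0")
  case False
  let ?c = "cinner f g"
  \<comment> \<open>Rotating \<open>f\<close> makes the inner product real, so that the real Cauchy-Schwarz inequality applies.\<close>
  have "cnj ?c * ?c = of_real ((norm ?c)\<^sup>2)"
    by (metis complex_norm_square mult.commute)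
  then have "(norm ?c)\<^sup>2 = inner (cnj ?c *\<^sub>C f) g"
    by (simp only: inner_hardy_def cinner_scaleC_left Re_complex_of_real)
  also have "\<dots> \<le> norm (cnj ?c *\<^sub>C f) * norm g"
    by (rule norm_cauchy_schwarz)
  finally have "norm ?c * norm ?c \<le> norm ?c * (norm f * norm g)"
    by (simp add: power2_eq_square mult.assoc)
  then show ?thesis using False by simp
qed simp

lemma bounded_linear_cinner_left: "bounded_linear (\<lambda>f. cinner f g)"
  by (rule bounded_linear_intro[where K="norm g"])
     (auto simp: cinner_add_left norm_cinner_le scaleR_conv_of_real cinner_scaleC_left
           simp flip: scaleC_of_real)

section \<open>An obstruction to geodesics\<close>

lemma bounded_operator_scaleC:
  assumes "bounded_operator X" shows "bounded_operator (\<lambda>f. c *\<^sub>C X f)"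
proof -
  obtain K where lin: "Vector_Spaces.linear scaleC scaleC X" and K: "\<And>f. norm (X f) \<le> K * norm f"
    using assms by (auto simp: bounded_operator_def)
  have "Vector_Spaces.linear scaleC scaleC (\<lambda>f. c *\<^sub>C X f)"
    using lin by (auto simp: Vector_Spaces.linear_iff hardy.scale_right_distrib hardy.scale_left_commute)
  moreover have "norm (c *\<^sub>C X f) \<le> (norm c * K) * norm f" for f
    using mult_left_mono[OF K, of "norm c" f] by (simp add: mult.assoc)
  ultimately show ?thesis by (auto simp: bounded_operator_def)
qed

text \<open>
  Self-adjointness moves each power of \<open>X\<close> onto \<open>f\<close>, so that only the first term of the exponential
  series contributes.
\<close>

lemma cinner_op_exp_null:
  assumes X: "bounded_operator X" "selfadjoint X" and f: "X f = 0"
  shows "cinner (op_exp (\<lambda>g. c *\<^sub>C X g) s) f = cinner s f"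
proof -
  let ?A = "\<lambda>g. c *\<^sub>C X g"
  have "(\<lambda>n. cinner ((?A ^^ n) s /\<^sub>R fact n) f) sums cinner (op_exp ?A s) f"
    by (rule bounded_linear.sums[OF bounded_linear_cinner_left
             op_exp_sums[OF bounded_operator_scaleC[OF X(1)]]])
  moreover have "cinner ((?A ^^ n) s /\<^sub>R fact n) f = (if n = 0 then cinner s f else 0)" for n
  proof (cases n)
    case (Suc m)
    have "cinner (X g) f = 0" for g
      using X(2) f by (simp add: selfadjoint_def cinner_def)
    then show ?thesis
      using Suc by (simp add: cinner_scaleC_left flip: scaleC_of_real)
  qed simp
  ultimately have "(\<lambda>n. if n = 0 then cinner s f else 0) sums cinner (op_exp ?A s) f"
    by simp
  then show ?thesis
    using sums_single[of 0 "\<lambda>_. cinner s f"] sums_unique2 by fastforce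
qed

text \<open>
  A geodesic requires \<open>dim (S \<inter> T\<^sup>\<bottom>) = dim (S\<^sup>\<bottom> \<inter> T)\<close>; this is the case where the left-hand side is 0.
\<close>

lemma geodesic_ortho_compl_Int_trivial:
  assumes geo: "geodesic_joining \<delta> S T" and triv: "S \<inter> ortho_compl T \<subseteq> {0}"
    and f: "f \<in> ortho_compl S" "f \<in> T"
  shows "f = 0"
proof -
  obtain X where X: "bounded_operator X" "selfadjoint X" "codiagonal X S" "codiagonal X T"
    and "\<forall>t\<in>{0..1}. \<delta> t = op_exp (\<lambda>f. (\<i> * of_real t) *\<^sub>C X f) ` S" and "\<delta> 1 = T"
    using geo by (auto simp: geodesic_joining_def)
  then have T: "T = op_exp (\<lambda>f. (\<i> * of_real 1) *\<^sub>C X f) ` S"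
    by (metis atLeastAtMost_iff order.refl zero_le_one)
  have "X f = 0"
    using X(3,4) f triv unfolding codiagonal_def by blast
  obtain s where s: "s \<in> S" "f = op_exp (\<lambda>f. (\<i> * of_real 1) *\<^sub>C X f) s"
    using f(2) T by auto
  have "cinner f f = cinner s f"
    using cinner_op_exp_null[OF X(1,2) \<open>X f = 0\<close>, of "\<i> * of_real 1" s] s(2) by simp
  also have "\<dots> = 0"
    using f(1) s(1) cinner_commute[of s f] by (simp add: ortho_compl_def)
  finally show ?thesis by (simp add: cinner_self_eq_0_iff)
qed

section \<open>The reproducing kernel\<close>

definition kernel :: "complex \<Rightarrow> hardy" where
  "kernel w = Abs_hardy (\<lambda>z. if norm z < 1 then \<Sum>n. cnj w ^ n * z ^ n else 0)"

lemma kernel_l2: "norm w < 1 \<Longrightarrow> summable (\<lambda>n. (norm (cnj w ^ n))\<^sup>2)"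
  by (rule l1_imp_l2) (simp add: norm_power summable_geometric)

lemma hcoeff_kernel: "norm w < 1 \<Longrightarrow> hcoeff (kernel w) n = cnj w ^ n"
  using hardy_set_of_seq[OF kernel_l2] by (simp add: hcoeff_def kernel_def Abs_hardy_inverse)

lemma hfun_kernel:
  assumes "norm w < 1" "norm z < 1"
  shows "hfun (kernel w) z = 1 / (1 - cnj w * z)"
proof -
  have "norm (cnj w * z) < 1"
    using assms mult_strict_mono'[of "norm w" 1 "norm z" 1] by (simp add: norm_mult)
  then have "(\<lambda>n. hcoeff (kernel w) n * z ^ n) sums (1 / (1 - cnj w * z))"
    using geometric_sums[of "cnj w * z"] by (simp add: hcoeff_kernel[OF assms(1)] power_mult_distrib)
  then show ?thesis
    using sums_unique2[OF hfun_sums[OF assms(2)]] by blast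
qed

lemma cinner_kernel: "norm w < 1 \<Longrightarrow> cinner f (kernel w) = hfun f w"
  using sums_unique2[OF cinner_sums[of f "kernel w"]] hfun_sums[of w f] by (simp add: hcoeff_kernel)

text \<open>The Cauchy-Schwarz inequality for \<open>f(z) = \<langle>f, k\<^sub>z\<rangle>\<close>, with \<open>\<parallel>k\<^sub>z\<parallel>\<^sup>2 = 1 / (1 - |z|\<^sup>2)\<close>.\<close>

lemma hardy_growth:
  assumes z: "norm z < 1"
  shows "(norm (hfun f z))\<^sup>2 * (1 - (norm z)\<^sup>2) \<le> (norm f)\<^sup>2"
proof -
  have pos: "0 < 1 - (norm z)\<^sup>2" using z by (simp add: abs_square_less_1)
  have "(norm (kernel z))\<^sup>2 = Re (cinner (kernel z) (kernel z))"
    by (simp add: power2_norm_eq_inner inner_hardy_def)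
  also have "cinner (kernel z) (kernel z) = of_real (1 / (1 - (norm z)\<^sup>2))"
  proof -
    have "cnj z * z = of_real ((norm z)\<^sup>2)" by (metis complex_norm_square mult.commute)
    then show ?thesis using z by (simp add: cinner_kernel hfun_kernel)
  qed
  finally have k: "(norm (kernel z))\<^sup>2 = 1 / (1 - (norm z)\<^sup>2)" by simp
  have "(norm (hfun f z))\<^sup>2 \<le> (norm f * norm (kernel z))\<^sup>2"
    using norm_cinner_le[of f "kernel z"] z by (intro power_mono) (auto simp: cinner_kernel)
  then show ?thesis
    using pos by (simp add: power_mult_distrib k field_simps)
qed

section \<open>Functions orthogonal to the invariant functions\<close>

lemma one_minus_cnj_mult_nonzero:
  fixes a z :: complex
  assumes "norm a < 1" "norm z < 1" shows "1 - cnj a * z \<noteq> 0"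
proof -
  have "norm (cnj a * z) < 1"
    using assms mult_strict_mono'[of "norm a" 1 "norm z" 1] by (simp add: norm_mult)
  then show ?thesis by auto
qed

lemma disk_inv_involution:
  assumes "norm a < 1" "norm z < 1" shows "disk_inv a (disk_inv a z) = z"
proof -
  have nz: "1 - cnj a * z \<noteq> 0" "1 - cnj a * a \<noteq> 0"
    using one_minus_cnj_mult_nonzero assms by auto
  have "a - disk_inv a z = z * (1 - cnj a * a) / (1 - cnj a * z)"
    "1 - cnj a * disk_inv a z = (1 - cnj a * a) / (1 - cnj a * z)"
    using nz(1) by (simp_all add: disk_inv_def field_simps)
  then show ?thesis
    using nz by (simp add: disk_inv_def[of a "disk_inv a z"])
qed

lemma kernel_0_invariant:
  assumes "norm a < 1"
  shows "kernel 0 \<in> nullspace (\<lambda>f. comp_op a f - f)"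
  using norm_disk_inv_less[OF assms] by (simp add: nullspace_comp_op[OF assms] hfun_kernel)

text \<open>
  Composition with \<open>\<phi>\<^sub>a\<close> moves the pole of \<open>k\<^sub>w\<close>, so that \<open>k\<^sub>w \<circ> \<phi>\<^sub>a\<close> is a combination of 1 and the
  kernel at \<open>\<phi>\<^sub>a(w)\<close>.  The factor on the left clears a denominator that vanishes for \<open>w = a\<close>.
\<close>

lemma comp_op_kernel:
  assumes a: "norm a < 1" and w: "norm w < 1"
  shows "cnj (a - w) *\<^sub>C comp_op a (kernel w)
         = cnj a *\<^sub>C kernel 0 + cnj (disk_inv a w - a) *\<^sub>C kernel (disk_inv a w)"
proof (rule hardy_eqI)
  fix z :: complex assume z: "norm z < 1"
  have b: "norm (disk_inv a w) < 1" and az: "norm (disk_inv a z) < 1"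
    using norm_disk_inv_less a w z by auto
  define A W where "A = cnj a" and "W = cnj w"
  have nz: "1 - A * z \<noteq> 0" "1 - a * W \<noteq> 0"
    using one_minus_cnj_mult_nonzero[OF a z] one_minus_cnj_mult_nonzero[OF w a]
    by (auto simp: A_def W_def mult.commute)
  have d1: "1 - W * ((a - z) / (1 - A * z)) \<noteq> 0"
    using one_minus_cnj_mult_nonzero[OF w az] by (simp add: A_def W_def disk_inv_def)
  have d2: "1 - (A - W) / (1 - a * W) * z \<noteq> 0"
    using one_minus_cnj_mult_nonzero[OF b z] by (simp add: A_def W_def disk_inv_def)
  define E where "E = (1 - A * z) - W * (a - z)"
  have E1: "1 - W * ((a - z) / (1 - A * z)) = E / (1 - A * z)"
    using nz by (simp add: E_def field_simps)
  have E2: "1 - (A - W) / (1 - a * W) * z = E / (1 - a * W)"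
    using nz by (simp add: E_def field_simps)
  have E0: "E \<noteq> 0" using d1 E1 by auto
  have "(A - W) * (1 / (1 - W * ((a - z) / (1 - A * z))))
        = A + ((A - W) / (1 - a * W) - A) * (1 / (1 - (A - W) / (1 - a * W) * z))"
    unfolding E1 E2
    using nz E0 by (simp add: divide_simps) (simp add: E_def algebra_simps)
  then show "hfun (cnj (a - w) *\<^sub>C comp_op a (kernel w)) z =
     hfun (cnj a *\<^sub>C kernel 0 + cnj (disk_inv a w - a) *\<^sub>C kernel (disk_inv a w)) z"
    using z w b az by (simp add: hfun_comp_op[OF a z] hfun_kernel A_def W_def disk_inv_def)
qed

text \<open>
  The condition \<open>f(0) = 0\<close> removes the contribution of the constant term of \<open>k\<^sub>w \<circ> \<phi>\<^sub>a\<close>.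
\<close>

lemma ortho_invariant_imp_functional_eq:
  assumes a: "norm a < 1" and w: "norm w < 1"
    and f: "f \<in> ortho_compl (nullspace (\<lambda>f. comp_op a f - f))" and f0: "hfun f 0 = 0"
  shows "(a - w) * hfun f w = (a - disk_inv a w) * hfun f (disk_inv a w)"
proof -
  let ?k = "kernel w" and ?b = "disk_inv a w"
  have "?k + comp_op a ?k \<in> nullspace (\<lambda>f. comp_op a f - f)"
    by (simp add: nullspace_comp_op[OF a] hfun_comp_op[OF a] norm_disk_inv_less[OF a]
        disk_inv_involution[OF a] add.commute)
  then have "cinner f (?k + comp_op a ?k) = 0"
    using f by (simp add: ortho_compl_def)
  then have *: "cinner f (comp_op a ?k) = - hfun f w"
    by (simp add: cinner_add_right cinner_kernel[OF w] eq_neg_iff_add_eq_0 add.commute)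
  have "cinner f (cnj (a - w) *\<^sub>C comp_op a ?k)
        = cinner f (cnj a *\<^sub>C kernel 0 + cnj (?b - a) *\<^sub>C kernel ?b)"
    using comp_op_kernel[OF a w] by simp
  then have "(a - w) * (- hfun f w) = (?b - a) * hfun f ?b"
    using f0 norm_disk_inv_less[OF a w]
    by (simp add: cinner_scaleC_right cinner_add_right * cinner_kernel)
  then show ?thesis by (simp add: algebra_simps)
qed

text \<open>
  The automorphism \<open>\<psi>(z) = \<phi>\<^sub>a(-z)\<close> preserves the diameter through \<open>a\<close>, and \<open>t'\<close> is the parameter of
  \<open>\<psi>(ta)\<close>.  The last identity is \<open>1 - |\<psi>|\<^sup>2 = |\<psi>'| (1 - |z|\<^sup>2)\<close>, which is the invariance of the
  hyperbolic metric; since \<open>|\<psi>'| \<le> 1 - |a|\<^sup>2\<close> here, orbits approach the circle geometrically.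
\<close>

lemma radial_step:
  fixes a :: complex and t :: real
  defines "t' \<equiv> (1 + t) / (1 + (norm a)\<^sup>2 * t)"
  assumes a: "norm a < 1" and t: "0 < t" "t * norm a < 1"
  shows "disk_inv a (- (of_real t * a)) = of_real t' * a"
    and "1 \<le> t'" and "t' * norm a < 1"
    and "t' - 1 = t * (1 - (norm a)\<^sup>2) / (1 + (norm a)\<^sup>2 * t)"
    and "1 - (t' * norm a)\<^sup>2 = (1 - (norm a)\<^sup>2) * (1 - (t * norm a)\<^sup>2) / (1 + (norm a)\<^sup>2 * t)\<^sup>2"
proof -
  let ?r = "norm a"
  have r: "?r\<^sup>2 < 1" using a by (simp add: abs_square_less_1)
  have pos: "0 < 1 + ?r\<^sup>2 * t" using t by (simp add: add_pos_nonneg)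
  have "cnj a * a = of_real (?r\<^sup>2)" by (metis complex_norm_square mult.commute)
  then have "1 - cnj a * (- (of_real t * a)) = of_real (1 + ?r\<^sup>2 * t)"
    by (simp add: algebra_simps)
  moreover have "a - (- (of_real t * a)) = of_real (1 + t) * a"
    by (simp add: algebra_simps)
  ultimately show "disk_inv a (- (of_real t * a)) = of_real t' * a"
    by (simp add: disk_inv_def t'_def)
  show d: "t' - 1 = t * (1 - ?r\<^sup>2) / (1 + ?r\<^sup>2 * t)"
    using pos by (simp add: t'_def field_simps)
  then have "0 \<le> t' - 1" using t r pos by simp
  then show "1 \<le> t'" by simp
  show e: "1 - (t' * ?r)\<^sup>2 = (1 - ?r\<^sup>2) * (1 - (t * ?r)\<^sup>2) / (1 + ?r\<^sup>2 * t)\<^sup>2"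
  proof -
    have "1 - (t' * ?r)\<^sup>2 = ((1 + ?r\<^sup>2 * t)\<^sup>2 - (1 + t)\<^sup>2 * ?r\<^sup>2) / (1 + ?r\<^sup>2 * t)\<^sup>2"
      using pos by (simp add: t'_def power_mult_distrib power_divide diff_divide_distrib)
    also have "(1 + ?r\<^sup>2 * t)\<^sup>2 - (1 + t)\<^sup>2 * ?r\<^sup>2 = (1 - ?r\<^sup>2) * (1 - (t * ?r)\<^sup>2)"
      by (simp add: power2_eq_square algebra_simps)
    finally show ?thesis .
  qed
  have "(t * ?r)\<^sup>2 < 1" using t by (simp add: abs_square_less_1)
  then have "0 < 1 - (t' * ?r)\<^sup>2" unfolding e using r pos by simp
  then have "(t' * ?r)\<^sup>2 < 1" by simp
  then show "t' * ?r < 1" by (simp only: abs_square_less_1 abs_less_iff)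
qed

text \<open>
  The bound on \<open>(1 - |z|\<^sup>2) |f(z)| / |z|\<close> at \<open>z = ta\<close> comes from the \<open>n\<close>-th orbit point, where
  \<open>1 - |z|\<^sup>2 \<le> (1 - |a|\<^sup>2)\<^sup>n\<close>.  Starting with \<open>t \<ge> 1\<close> keeps \<open>|z| \<ge> |a|\<close> along the orbit.
\<close>

lemma radial_invariant_bound:
  fixes a :: complex
  assumes a: "norm a < 1" "a \<noteq> 0"
    and inv: "\<And>z. norm z < 1 \<Longrightarrow>
           (a + z) * hfun f z = (disk_inv a (- z) - a) * hfun f (disk_inv a (- z))"
    and t: "1 \<le> t" "t * norm a < 1"
  shows "((1 - (t * norm a)\<^sup>2) * norm (hfun f (of_real t * a)) / t)\<^sup>2
           \<le> (norm f)\<^sup>2 * (1 - (t * norm a)\<^sup>2) * (1 - (norm a)\<^sup>2) ^ n"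
  using t
proof (induction n arbitrary: t)
  case 0
  let ?D = "1 - (t * norm a)\<^sup>2" and ?F = "norm (hfun f (of_real t * a))"
  have D: "0 \<le> ?D" using 0 by (simp add: abs_square_le_1)
  have "(?D * ?F / t)\<^sup>2 \<le> (?D * ?F)\<^sup>2"
    using 0 D divide_left_mono[of 1 t "?D * ?F"] by (intro power_mono) auto
  also have "\<dots> = (?F\<^sup>2 * ?D) * ?D" by (simp add: power2_eq_square)
  also have "\<dots> \<le> (norm f)\<^sup>2 * ?D"
    using hardy_growth[of "of_real t * a" f] 0 D
    by (intro mult_right_mono) (auto simp: norm_mult)
  finally show ?case by simp
next
  case (Suc n)
  let ?r = "norm a"
  define t' where "t' = (1 + t) / (1 + ?r\<^sup>2 * t)"
  have t0: "0 < t" using Suc.prems by simp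
  note st = radial_step[OF a(1) t0 Suc.prems(2), folded t'_def]
  have pos: "0 < 1 + ?r\<^sup>2 * t" using t0 by (simp add: add_pos_nonneg)
  have "norm (of_real t * a) < 1" using Suc.prems by (simp add: norm_mult)
  from inv[OF this]
  have "(a + of_real t * a) * hfun f (of_real t * a) = (of_real t' * a - a) * hfun f (of_real t' * a)"
    by (simp only: st(1))
  then have "a * (of_real (1 + t) * hfun f (of_real t * a))
      = a * (of_real (t' - 1) * hfun f (of_real t' * a))"
    by (simp add: algebra_simps)
  then have "of_real (1 + t) * hfun f (of_real t * a) = of_real (t' - 1) * hfun f (of_real t' * a)"
    using a(2) by (simp only: mult_cancel_left) simp
  then have "norm (of_real (1 + t) * hfun f (of_real t * a))
      = norm (of_real (t' - 1) * hfun f (of_real t' * a))" by simp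
  then have F: "(1 + t) * norm (hfun f (of_real t * a)) = (t' - 1) * norm (hfun f (of_real t' * a))"
    using t0 st(2) unfolding norm_mult norm_of_real by simp
  define p where "p = 1 + ?r\<^sup>2 * t"
  define F0 F1 where "F0 = norm (hfun f (of_real t * a))" and "F1 = norm (hfun f (of_real t' * a))"
  have p: "0 < p" and t'p: "t' * p = 1 + t" using pos by (auto simp: p_def t'_def)
  have F': "t' * p * F0 = t * (1 - ?r\<^sup>2) / p * F1"
    using F by (simp only: t'p st(4)[folded p_def] F0_def F1_def)
  \<comment> \<open>The invariant quantity has the same value at both points, up to the common factor \<open>|a|\<close>.\<close>
  have eq: "(1 - (t * ?r)\<^sup>2) * F0 / t = (1 - (t' * ?r)\<^sup>2) * F1 / t'"
  proof -
    have "F0 / t = (1 - ?r\<^sup>2) / p\<^sup>2 * F1 / t'"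
      using F' p t0 st(2) by (simp add: divide_simps power2_eq_square) (simp add: mult_ac)
    then have "(1 - (t * ?r)\<^sup>2) * (F0 / t) = (1 - (t * ?r)\<^sup>2) * ((1 - ?r\<^sup>2) / p\<^sup>2 * F1 / t')"
      by simp
    then show ?thesis
      unfolding st(5)[folded p_def] by (simp add: mult_ac)
  qed
  have "((1 - (t * ?r)\<^sup>2) * F0 / t)\<^sup>2
        \<le> (norm f)\<^sup>2 * (1 - (t' * ?r)\<^sup>2) * (1 - ?r\<^sup>2) ^ n"
    using Suc.IH[OF st(2,3)] unfolding eq F1_def .
  also have "\<dots> \<le> (norm f)\<^sup>2 * ((1 - (t * ?r)\<^sup>2) * (1 - ?r\<^sup>2)) * (1 - ?r\<^sup>2) ^ n"
  proof (intro mult_right_mono mult_left_mono)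
    have r: "0 \<le> 1 - ?r\<^sup>2" using a(1) by (simp add: abs_square_le_1)
    then show "0 \<le> (1 - ?r\<^sup>2) ^ n" by simp
    have "0 \<le> 1 - (t * ?r)\<^sup>2" using Suc.prems by (simp add: abs_square_le_1)
    moreover have "1 \<le> p\<^sup>2" using t0 by (simp add: p_def one_le_power)
    ultimately show "1 - (t' * ?r)\<^sup>2 \<le> (1 - (t * ?r)\<^sup>2) * (1 - ?r\<^sup>2)"
      unfolding st(5)[folded p_def] using r p
        divide_left_mono[of 1 "p\<^sup>2" "(1 - ?r\<^sup>2) * (1 - (t * ?r)\<^sup>2)"]
      by (simp add: mult.commute)
  qed simp
  finally show ?case by (simp add: F0_def mult_ac)
qed

lemma odd_functional_eq_imp_zero:
  fixes a :: complex
  assumes a: "norm a < 1" "a \<noteq> 0"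
    and odd: "\<And>z. norm z < 1 \<Longrightarrow> hfun f (- z) = - hfun f z"
    and eq: "\<And>w. norm w < 1 \<Longrightarrow> (a - w) * hfun f w = (a - disk_inv a w) * hfun f (disk_inv a w)"
  shows "f = 0"
proof (rule hardy_eqI)
  have inv: "(a + z) * hfun f z = (disk_inv a (- z) - a) * hfun f (disk_inv a (- z))"
    if "norm z < 1" for z
    using eq[of "- z"] odd[OF that] that by (simp add: algebra_simps)
  have vanish: "hfun f (of_real t * a) = 0" if t: "1 \<le> t" "t * norm a < 1" for t
  proof -
    let ?D = "1 - (t * norm a)\<^sup>2"
    have "(\<lambda>n. (norm f)\<^sup>2 * ?D * (1 - (norm a)\<^sup>2) ^ n) \<longlonglongrightarrow> (norm f)\<^sup>2 * ?D * 0"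
      using a by (intro tendsto_mult_left LIMSEQ_power_zero) (auto simp: abs_square_less_1 abs_square_le_1)
    then have "(?D * norm (hfun f (of_real t * a)) / t)\<^sup>2 \<le> (norm f)\<^sup>2 * ?D * 0"
      by (rule LIMSEQ_le_const) (use radial_invariant_bound[OF a inv t] in blast)
    then have "?D * norm (hfun f (of_real t * a)) / t = 0" by simp
    moreover have "?D \<noteq> 0" using t by (simp add: abs_square_less_1 less_imp_neq[symmetric])
    ultimately show ?thesis using t by simp
  qed
  define U where "U = (\<lambda>t. of_real t * a) ` {t. 1 \<le> t \<and> t * norm a < 1}"
  have lim: "a islimpt U"
    unfolding islimpt_approachable
  proof (intro allI impI)
    fix e :: real assume e: "0 < e"
    define d where "d = min (e / 2) ((1 - norm a) / 2)"
    have d: "0 < d" "d < e" "norm a + d < 1" using e a by (auto simp: d_def min_def field_simps)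
    define t where "t = 1 + d / norm a"
    have ta: "t * norm a = norm a + d" using a by (simp add: t_def field_simps)
    have "1 \<le> t" using d a by (simp add: t_def)
    then have "of_real t * a \<in> U" using ta d by (auto simp: U_def)
    moreover have diff: "of_real t * a - a = of_real (d / norm a) * a"
      by (simp add: t_def algebra_simps)
    then have "dist (of_real t * a) a = d"
      using d a by (simp only: dist_norm norm_mult norm_of_real) simp
    ultimately show "\<exists>x'\<in>U. x' \<noteq> a \<and> dist x' a < e"
      using d by (intro bexI[of _ "of_real t * a"]) auto
  qed
  fix z :: complex assume z: "norm z < 1"
  have "hfun f z = 0"
  proof (rule analytic_continuation[OF hfun_holomorphic _ _ _ _ lim])
    show "U \<subseteq> ball 0 1" by (auto simp: U_def norm_mult)
    show "hfun f x = 0" if "x \<in> U" for x using that vanish by (auto simp: U_def)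
  qed (use z a in auto)
  then show "hfun f z = hfun 0 z" by simp
qed

section \<open>The odd functions and the invariant functions\<close>

lemma odd_iff:
  "f \<in> nullspace (\<lambda>f. comp_op 0 f + f) \<longleftrightarrow> (\<forall>z. norm z < 1 \<longrightarrow> hfun f (- z) = - hfun f z)"
  by (simp add: nullspace_comp_op disk_inv_def)

lemma odd_at_0: "f \<in> nullspace (\<lambda>f. comp_op 0 f + f) \<Longrightarrow> hfun f 0 = 0"
  using odd_iff[of f] by (auto dest!: spec[of _ 0])

theorem corollary6p2:
  fixes a :: complex
  assumes "norm a < 1" and "a \<noteq> 0"
  shows "\<not> (\<exists>\<delta>. geodesic_joining \<delta> (nullspace (\<lambda>f. comp_op 0 f + f)) (nullspace (\<lambda>f. comp_op a f - f)))"
proof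
  let ?S = "nullspace (\<lambda>f. comp_op 0 f + f)" and ?T = "nullspace (\<lambda>f. comp_op a f - f)"
  assume "\<exists>\<delta>. geodesic_joining \<delta> ?S ?T"
  then obtain \<delta> where geo: "geodesic_joining \<delta> ?S ?T" by blast
  have "?S \<inter> ortho_compl ?T \<subseteq> {0}"
  proof
    fix f assume f: "f \<in> ?S \<inter> ortho_compl ?T"
    then have "f = 0"
      using odd_iff[of f] odd_at_0 ortho_invariant_imp_functional_eq[OF assms(1)]
      by (intro odd_functional_eq_imp_zero[OF assms]) auto
    then show "f \<in> {0}" by simp
  qed
  \<comment> \<open>The kernel at the origin is the constant function 1.\<close>
  moreover have "kernel 0 \<in> ortho_compl ?S"
  proof -
    have "cinner (kernel 0) g = 0" if "g \<in> ?S" for g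
      using odd_at_0[OF that] cinner_commute[of "kernel 0" g] by (simp add: cinner_kernel)
    then show ?thesis by (simp add: ortho_compl_def)
  qed
  ultimately have "kernel 0 = 0"
    using geodesic_ortho_compl_Int_trivial[OF geo] kernel_0_invariant[OF assms(1)] by blast
  then show False using hfun_kernel[of 0 0] by simp
qed

end
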